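(* Let $N\in\{1,2\}$ and $n\ge2$. If $B=(\beta_{ij})_{ij}\in S(n)$ is strictly copositive, then the system $$-\Delta u_i=\sum_{j=1}^n\beta_{ij}u_j^2u_i,\qquad u_1,\dots,u_n\ge 0\qquad\text{in }\mathbb{R}^N\qquad(i=1,\dots,n)$$ does not admit a nontrivial solution.
   Context: $S(n)$ denotes the space of symmetric $n\times n$ matrices with real coefficients, and $C^n_+=\{c\in\mathbb{R}^n: c_i\ge 0 \text{ for all } i\}$. A matrix $B=(\beta_{ij})_{ij}\in S(n)$ is strictly copositive if $\sum_{i,j=1}^n\beta_{ij}c_ic_j>0$ for all $c\in C^n_+\setminus\{0\}$. A solution $u=(u_1,\dots,u_n)$ of the system (all components nonnegative) is called nontrivial if $u_i\not\equiv 0$ for at least one $i$. *)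

theory Defs
  imports "HOL-Analysis.Analysis"
begin

text \<open>On \<^typ>\<open>real^'N\<close> the set \<^const>\<open>Basis\<close> consists of the standard unit vectors, so
  these are the usual partial derivatives. They are meaningful only at points of
  differentiability; \<open>C1\<close> below therefore demands Frechet differentiability
  explicitly, which, given continuous partial derivatives, is the usual notion.\<close>

definition partial_deriv :: "('a::euclidean_space \<Rightarrow> real) \<Rightarrow> 'a \<Rightarrow> 'a \<Rightarrow> real" where
  "partial_deriv f b x = frechet_derivative f (at x) b"

definition C1 :: "('a::euclidean_space \<Rightarrow> real) \<Rightarrow> bool" where
  "C1 f \<longleftrightarrow> (\<forall>x. f differentiable (at x)) \<and>
     (\<forall>b\<in>Basis. continuous_on UNIV (partial_deriv f b))"

definition C2 :: "('a::euclidean_space \<Rightarrow> real) \<Rightarrow> bool" where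
  "C2 f \<longleftrightarrow> C1 f \<and> (\<forall>b\<in>Basis. C1 (partial_deriv f b))"

definition laplacian :: "('a::euclidean_space \<Rightarrow> real) \<Rightarrow> 'a \<Rightarrow> real" where
  "laplacian f x = (\<Sum>b\<in>Basis. partial_deriv (partial_deriv f b) b x)"

definition strictly_copositive :: "real^'n^'n \<Rightarrow> bool" where
  "strictly_copositive B \<longleftrightarrow>
     (\<forall>c :: real^'n. (\<forall>i. c $ i \<ge> 0) \<and> c \<noteq> 0 \<longrightarrow>
        (\<Sum>i\<in>UNIV. \<Sum>j\<in>UNIV. B $ i $ j * c $ i * c $ j) > 0)"

text \<open>Solutions are understood in the classical sense, on the whole space; the sign
  condition on the components is part of the system, and no growth, decay or boundedness
  is required.\<close>

definition is_solution :: "real^'n^'n \<Rightarrow> (real^'N \<Rightarrow> real^'n) \<Rightarrow> bool" where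
  "is_solution B u \<longleftrightarrow>
     (\<forall>i. C2 (\<lambda>x. u x $ i)) \<and>
     (\<forall>i x. u x $ i \<ge> 0) \<and>
     (\<forall>i x. - laplacian (\<lambda>y. u y $ i) x
               = (\<Sum>j\<in>UNIV. B $ i $ j * (u x $ j)^2 * u x $ i))"

definition nontrivial :: "(real^'N \<Rightarrow> real^'n) \<Rightarrow> bool" where
  "nontrivial u \<longleftrightarrow> (\<exists>i. (\<lambda>x. u x $ i) \<noteq> (\<lambda>x. 0))"

end

theory Submission imports Defs begin

text \<open>
  On the whole of \<open>\<real>\<^sup>N\<close> with \<open>N \<le> 2\<close> there is no nonnegative function with strictly
  negative Laplacian (\<open>no_strictly_superharmonic_nonneg\<close>): the logarithm tends to
  infinity and is superharmonic away from the origin, so comparison with \<open>\<epsilon> ln \<bar>x\<bar>\<close> shows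
  that such a function attains its minimum, where the Laplacian cannot be negative. A nontrivial
  solution \<open>u\<close> would produce such a function, namely a weighted geometric mean of those
  components that do not vanish identically.

  Let \<open>J\<close> be the set of indices of these components. Each equation has the form
  \<open>\<Delta> u\<^sub>i = V\<^sub>i u\<^sub>i\<close> with continuous \<open>V\<^sub>i = - (B u\<^sup>2)\<^sub>i\<close>, so a component that is positive
  somewhere is positive everywhere (\<open>strong_minimum_principle\<close>). Minimising the quadratic form
  of \<open>B\<close> over the probability vectors supported in \<open>J\<close> gives weights \<open>y\<close> with
  \<open>(B y)\<^sub>j > 0\<close> for \<open>j \<in> J\<close> (\<open>copositive_weights\<close>). For \<open>W = \<Prod> u\<^sub>i\<^bsup>y\<^sub>i\<^esup>\<close> the convexity of the
  square gives \<open>\<Delta> W \<le> W \<Sum> y\<^sub>i \<Delta> u\<^sub>i / u\<^sub>i\<close> (\<open>geometric_mean_has_laplacian\<close>), and by the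
  symmetry of \<open>B\<close> the right hand side is \<open>- W \<Sum> (B y)\<^sub>j u\<^sub>j\<^sup>2\<close>, which is negative.

  All arguments are pointwise and use only the second derivative test at a minimum.
\<close>

section \<open>Laplacians by second derivatives along lines\<close>

text \<open>Only one-dimensional derivatives along the line through \<open>x\<close> in direction \<open>b\<close> are
  required. This is all that the second derivative test uses, and it makes the calculus of
  barriers and of geometric means one-dimensional. The first derivative has to exist
  near \<open>x\<close> only, since logarithmic barriers are not differentiable at their centre.\<close>

definition second_dir_deriv :: "('a::real_vector \<Rightarrow> real) \<Rightarrow> 'a \<Rightarrow> 'a \<Rightarrow> real \<Rightarrow> bool" where
  "second_dir_deriv f b x d \<longleftrightarrow>
     (\<exists>f'. (\<forall>\<^sub>F t in nhds 0. ((\<lambda>s. f (x + s *\<^sub>R b)) has_real_derivative f' t) (at t)) \<and>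
           (f' has_real_derivative d) (at 0))"

definition has_laplacian :: "('a::euclidean_space \<Rightarrow> real) \<Rightarrow> 'a \<Rightarrow> real \<Rightarrow> bool" where
  "has_laplacian f x L \<longleftrightarrow>
     (\<exists>d. (\<forall>b\<in>Basis. second_dir_deriv f b x (d b)) \<and> L = (\<Sum>b\<in>Basis. d b))"

lemma second_dir_derivI:
  assumes "\<forall>\<^sub>F t in nhds 0. ((\<lambda>s. f (x + s *\<^sub>R b)) has_real_derivative f' t) (at t)"
    and "(f' has_real_derivative d) (at 0)"
  shows "second_dir_deriv f b x d"
  using assms unfolding second_dir_deriv_def by blast

lemma second_dir_deriv_add:
  assumes "second_dir_deriv f b x d" "second_dir_deriv g b x e"
  shows "second_dir_deriv (\<lambda>z. f z + g z) b x (d + e)"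
proof -
  obtain f' where f: "\<forall>\<^sub>F t in nhds 0. ((\<lambda>s. f (x + s *\<^sub>R b)) has_real_derivative f' t) (at t)"
    "(f' has_real_derivative d) (at 0)"
    using assms(1) unfolding second_dir_deriv_def by blast
  obtain g' where g: "\<forall>\<^sub>F t in nhds 0. ((\<lambda>s. g (x + s *\<^sub>R b)) has_real_derivative g' t) (at t)"
    "(g' has_real_derivative e) (at 0)"
    using assms(2) unfolding second_dir_deriv_def by blast
  have "\<forall>\<^sub>F t in nhds 0. ((\<lambda>s. f (x + s *\<^sub>R b) + g (x + s *\<^sub>R b))
      has_real_derivative f' t + g' t) (at t)"
    using f(1) g(1) by eventually_elim (rule DERIV_add)
  moreover have "((\<lambda>t. f' t + g' t) has_real_derivative d + e) (at 0)"
    using f(2) g(2) by (rule DERIV_add)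
  ultimately show ?thesis
    by (rule second_dir_derivI)
qed

lemma second_dir_deriv_cmult:
  assumes "second_dir_deriv f b x d"
  shows "second_dir_deriv (\<lambda>z. k * f z) b x (k * d)"
proof -
  obtain f' where f: "\<forall>\<^sub>F t in nhds 0. ((\<lambda>s. f (x + s *\<^sub>R b)) has_real_derivative f' t) (at t)"
    "(f' has_real_derivative d) (at 0)"
    using assms(1) unfolding second_dir_deriv_def by blast
  have "\<forall>\<^sub>F t in nhds 0. ((\<lambda>s. k * f (x + s *\<^sub>R b)) has_real_derivative k * f' t) (at t)"
    using f(1) by eventually_elim (rule DERIV_cmult)
  moreover have "((\<lambda>t. k * f' t) has_real_derivative k * d) (at 0)"
    using f(2) by (rule DERIV_cmult)
  ultimately show ?thesis
    by (rule second_dir_derivI)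
qed

lemma second_dir_deriv_const: "second_dir_deriv (\<lambda>z. k) b x 0"
  unfolding second_dir_deriv_def by (intro exI[of _ "\<lambda>_. 0"]) auto

lemma has_laplacian_add:
  assumes "has_laplacian f x L" "has_laplacian g x M"
  shows "has_laplacian (\<lambda>z. f z + g z) x (L + M)"
proof -
  obtain d e where "\<forall>b\<in>Basis. second_dir_deriv f b x (d b)" "L = sum d Basis"
    "\<forall>b\<in>Basis. second_dir_deriv g b x (e b)" "M = sum e Basis"
    using assms unfolding has_laplacian_def by blast
  then show ?thesis
    unfolding has_laplacian_def
    by (intro exI[of _ "\<lambda>b. d b + e b"]) (auto intro: second_dir_deriv_add simp: sum.distrib)
qed

lemma has_laplacian_cmult:
  assumes "has_laplacian f x L"
  shows "has_laplacian (\<lambda>z. k * f z) x (k * L)"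
proof -
  obtain d where "\<forall>b\<in>Basis. second_dir_deriv f b x (d b)" "L = sum d Basis"
    using assms unfolding has_laplacian_def by blast
  then show ?thesis
    unfolding has_laplacian_def
    by (intro exI[of _ "\<lambda>b. k * d b"]) (auto intro: second_dir_deriv_cmult simp: sum_distrib_left)
qed

lemma has_laplacian_const: "has_laplacian (\<lambda>z. k) x 0"
  unfolding has_laplacian_def by (intro exI[of _ "\<lambda>_. 0"]) (auto intro: second_dir_deriv_const)

text \<open>This and the next lemma pass from the coordinate partial derivatives to the derivatives
  along lines, by the chain rule for the line \<open>s \<mapsto> x + s b\<close>.\<close>

lemma C1_line_derivative:
  assumes "C1 f"
  shows "((\<lambda>s. f (x + s *\<^sub>R b)) has_real_derivative partial_deriv f b (x + t *\<^sub>R b)) (at t)"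
proof -
  have "f differentiable (at (x + t *\<^sub>R b))"
    using assms unfolding C1_def by blast
  then have f: "(f has_derivative frechet_derivative f (at (x + t *\<^sub>R b))) (at (x + t *\<^sub>R b))"
    by (simp add: frechet_derivative_works)
  have l: "((\<lambda>s. x + s *\<^sub>R b) has_derivative (\<lambda>s. s *\<^sub>R b)) (at t)"
    by (auto intro!: derivative_eq_intros)
  have "((\<lambda>s. f (x + s *\<^sub>R b)) has_derivative
      (\<lambda>s. frechet_derivative f (at (x + t *\<^sub>R b)) (s *\<^sub>R b))) (at t)"
    using has_derivative_compose[OF l f] .
  moreover have "frechet_derivative f (at (x + t *\<^sub>R b)) (s *\<^sub>R b)
      = partial_deriv f b (x + t *\<^sub>R b) * s" for s
    using linear_scale[OF has_derivative_linear[OF f], of s b]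
    by (simp add: partial_deriv_def)
  ultimately show ?thesis
    by (simp add: has_field_derivative_def)
qed

lemma C2_has_laplacian:
  assumes "C2 f"
  shows "has_laplacian f x (laplacian f x)"
proof -
  have "second_dir_deriv f b x (partial_deriv (partial_deriv f b) b x)" if "b \<in> Basis" for b
  proof -
    have "C1 f" "C1 (partial_deriv f b)"
      using assms that unfolding C2_def by auto
    then show ?thesis
      unfolding second_dir_deriv_def
      using C1_line_derivative[of f x b] C1_line_derivative[of "partial_deriv f b" x b 0]
      by (intro exI[of _ "\<lambda>t. partial_deriv f b (x + t *\<^sub>R b)"]) auto
  qed
  then show ?thesis
    unfolding has_laplacian_def laplacian_def
    by (intro exI[of _ "\<lambda>b. partial_deriv (partial_deriv f b) b x"]) simp
qed

lemma C2_continuous: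
  assumes "C2 f"
  shows "continuous_on UNIV f"
  using assms unfolding C2_def C1_def
  by (auto intro!: continuous_at_imp_continuous_on differentiable_imp_continuous_within)

text \<open>Along a line in a unit direction \<open>b\<close> the squared distance \<open>Q\<close> to \<open>c\<close> is a quadratic
  polynomial with \<open>Q'(0) = 2 (x - c) \<bullet> b\<close> and \<open>Q'' = 2\<close>; the chain rule and the sum over the
  standard basis give \<open>4 r\<^sup>2 g''(r\<^sup>2) + 2 N g'(r\<^sup>2)\<close>. Writing radial functions in terms of \<open>r\<^sup>2\<close>
  avoids the derivative of the norm.\<close>

lemma has_laplacian_radial:
  fixes c x :: "'a::euclidean_space"
  assumes "x \<noteq> c"
    and g: "\<And>s. s > 0 \<Longrightarrow> (g has_real_derivative g' s) (at s)"
    and g': "(g' has_real_derivative g'') (at ((norm (x - c))\<^sup>2))"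
  shows "has_laplacian (\<lambda>z. g ((norm (z - c))\<^sup>2)) x
    (4 * (norm (x - c))\<^sup>2 * g'' + 2 * real DIM('a) * g' ((norm (x - c))\<^sup>2))"
proof -
  define y where "y = x - c"
  have y: "y \<noteq> 0" using assms(1) by (simp add: y_def)
  have "second_dir_deriv (\<lambda>z. g ((norm (z - c))\<^sup>2)) b x
      (4 * (y \<bullet> b)\<^sup>2 * g'' + 2 * g' ((norm y)\<^sup>2))" if b: "b \<in> Basis" for b
  proof -
    define Q where "Q = (\<lambda>t::real. (norm y)\<^sup>2 + 2 * t * (y \<bullet> b) + t\<^sup>2)"
    have Q: "(norm (x + t *\<^sub>R b - c))\<^sup>2 = Q t" for t
    proof -
      have "(norm (y + t *\<^sub>R b))\<^sup>2 = Q t"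
        unfolding Q_def power2_norm_eq_inner
        using b by (simp add: inner_simps inner_commute[of b y] power2_eq_square algebra_simps)
      moreover have "x + t *\<^sub>R b - c = y + t *\<^sub>R b" by (simp add: y_def)
      ultimately show ?thesis by (simp only:)
    qed
    have dQ: "(Q has_real_derivative 2 * (y \<bullet> b) + 2 * t) (at t)" for t
      unfolding Q_def by (auto intro!: derivative_eq_intros)
    have Q0: "Q 0 = (norm y)\<^sup>2" "Q 0 > 0" using y by (auto simp: Q_def)
    have "(Q \<longlongrightarrow> Q 0) (nhds 0)"
      using DERIV_isCont[OF dQ, of 0] by (simp add: continuous_at tendsto_at_iff_tendsto_nhds)
    then have ev: "\<forall>\<^sub>F t in nhds 0. Q t > 0"
      using Q0(2) order_tendstoD(1) by blast
    have "\<forall>\<^sub>F t in nhds 0. ((\<lambda>s. g (Q s)) has_real_derivative g' (Q t) * (2 * (y \<bullet> b) + 2 * t)) (at t)"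
      using ev by eventually_elim (rule DERIV_chain2[OF g dQ])
    moreover have "((\<lambda>t. g' (Q t) * (2 * (y \<bullet> b) + 2 * t)) has_real_derivative
        (4 * (y \<bullet> b)\<^sup>2 * g'' + 2 * g' ((norm y)\<^sup>2))) (at 0)"
    proof -
      have "((\<lambda>t. g' (Q t)) has_real_derivative g'' * (2 * (y \<bullet> b) + 2 * 0)) (at 0)"
        using g' by (intro DERIV_chain2[OF _ dQ]) (simp add: Q0 y_def)
      then show ?thesis
        by (auto intro!: derivative_eq_intros simp: Q0 power2_eq_square)
    qed
    ultimately show ?thesis
      by (intro second_dir_derivI) (simp_all only: Q)
  qed
  moreover have "(\<Sum>b\<in>Basis. 4 * (y \<bullet> b)\<^sup>2 * g'' + 2 * g' ((norm y)\<^sup>2))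
      = 4 * (norm y)\<^sup>2 * g'' + 2 * real DIM('a) * g' ((norm y)\<^sup>2)"
  proof -
    have "(norm y)\<^sup>2 = (\<Sum>b\<in>Basis. (y \<bullet> b)\<^sup>2)"
      by (simp only: power2_norm_eq_inner euclidean_inner[of y y]) (simp add: power2_eq_square)
    then show ?thesis
      by (simp add: sum.distrib sum_distrib_left sum_distrib_right)
  qed
  ultimately show ?thesis
    unfolding has_laplacian_def y_def[symmetric]
    by (intro exI[of _ "\<lambda>b. 4 * (y \<bullet> b)\<^sup>2 * g'' + 2 * g' ((norm y)\<^sup>2)"]) simp
qed

section \<open>Minimum principles\<close>

text \<open>The first derivative vanishes at the minimum; if the second were negative, the first would
  be negative shortly after, and the mean value theorem would give a smaller value.\<close>

lemma second_dir_deriv_local_min: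
  fixes f :: "'a::real_normed_vector \<Rightarrow> real"
  assumes "second_dir_deriv f b x d" "\<forall>\<^sub>F z in nhds x. f x \<le> f z"
  shows "d \<ge> 0"
proof (rule ccontr)
  assume "\<not> d \<ge> 0"
  then have d: "d < 0" by simp
  define \<phi> where "\<phi> = (\<lambda>s. f (x + s *\<^sub>R b))"
  obtain f' where f: "\<forall>\<^sub>F t in nhds 0. (\<phi> has_real_derivative f' t) (at t)"
    "(f' has_real_derivative d) (at 0)"
    using assms(1) unfolding second_dir_deriv_def \<phi>_def by blast
  have "isCont (\<lambda>s. x + s *\<^sub>R b) (0::real)"
    by (intro continuous_intros)
  then have "((\<lambda>s. x + s *\<^sub>R b) \<longlongrightarrow> x + 0 *\<^sub>R b) (nhds (0::real))"
    using tendsto_at_iff_tendsto_nhds[of "\<lambda>s. x + s *\<^sub>R b" 0] by (simp add: continuous_at)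
  then have m: "\<forall>\<^sub>F s in nhds 0. \<phi> 0 \<le> \<phi> s"
    using assms(2) unfolding \<phi>_def filterlim_iff by auto
  from eventually_conj[OF f(1) m] obtain e where e: "e > 0"
    "\<And>t. \<bar>t\<bar> < e \<Longrightarrow> (\<phi> has_real_derivative f' t) (at t) \<and> \<phi> 0 \<le> \<phi> t"
    unfolding eventually_nhds_metric by (auto simp: dist_real_def)
  have f0: "f' 0 = 0"
    using DERIV_local_min[of \<phi> "f' 0" 0 e] e by auto
  obtain r where r: "r > 0" "\<And>h. 0 < h \<Longrightarrow> h < r \<Longrightarrow> f' h < 0"
    using DERIV_neg_dec_right[OF f(2) d] f0 by auto
  define h where "h = min e r / 2"
  have h: "h > 0" "h < e" "h < r" using e(1) r(1) by (auto simp: h_def)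
  obtain z where z: "0 < z" "z < h" "\<phi> h - \<phi> 0 = (h - 0) * f' z"
    using MVT2[of 0 h \<phi> f'] h e(2) by auto
  have "f' z < 0" using r(2) z h by auto
  then have "\<phi> h < \<phi> 0"
    using z(3) h(1) mult_pos_neg[of h "f' z"] by simp
  moreover have "\<phi> 0 \<le> \<phi> h" using e(2)[of h] h by simp
  ultimately show False by simp
qed

lemma has_laplacian_local_min:
  assumes "has_laplacian f x L" "\<forall>\<^sub>F z in nhds x. f x \<le> f z"
  shows "L \<ge> 0"
proof -
  obtain d where "\<forall>b\<in>Basis. second_dir_deriv f b x (d b)" "L = sum d Basis"
    using assms(1) unfolding has_laplacian_def by blast
  then show ?thesis
    using second_dir_deriv_local_min[OF _ assms(2)] by (auto intro!: sum_nonneg)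
qed

text \<open>A negative minimum over the closed annulus would lie in its interior, where the second
  derivative test applies. Negativity of the Laplacian is demanded only where \<open>f < 0\<close>,
  because for equations with a zeroth order term it is available only there.\<close>

lemma annulus_comparison:
  fixes f :: "'a::euclidean_space \<Rightarrow> real"
  assumes cont: "continuous_on {x. r \<le> norm (x - c) \<and> norm (x - c) \<le> R} f"
    and bd: "\<And>x. norm (x - c) = r \<Longrightarrow> f x \<ge> 0" "\<And>x. norm (x - c) = R \<Longrightarrow> f x \<ge> 0"
    and int: "\<And>x. r < norm (x - c) \<Longrightarrow> norm (x - c) < R \<Longrightarrow> f x < 0
                \<Longrightarrow> \<exists>L<0. has_laplacian f x L"
    and p: "r \<le> norm (p - c)" "norm (p - c) \<le> R"
  shows "f p \<ge> 0"
proof -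
  define A where "A = {x. r \<le> norm (x - c) \<and> norm (x - c) \<le> R}"
  have "A = cball c R \<inter> {x. r \<le> norm (x - c)}"
    by (auto simp: A_def dist_norm norm_minus_commute)
  moreover have "closed {x. r \<le> norm (x - c)}"
    by (intro closed_Collect_le continuous_intros)
  ultimately have "compact A" by (simp add: compact_Int_closed)
  moreover have "p \<in> A" using p by (simp add: A_def)
  ultimately obtain x where x: "x \<in> A" "\<And>y. y \<in> A \<Longrightarrow> f x \<le> f y"
    using continuous_attains_inf[of A f] cont unfolding A_def by auto
  have "f x \<ge> 0"
  proof (rule ccontr)
    assume neg: "\<not> f x \<ge> 0"
    then have ne: "r < norm (x - c)" "norm (x - c) < R"
      using bd x(1) by (force simp: A_def less_le)+
    then obtain L where L: "L < 0" "has_laplacian f x L"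
      using int neg by force
    have "open {x. r < norm (x - c) \<and> norm (x - c) < R}"
      by (intro open_Collect_conj open_Collect_less continuous_intros)
    then have "\<forall>\<^sub>F z in nhds x. z \<in> {x. r < norm (x - c) \<and> norm (x - c) < R}"
      using ne by (intro eventually_nhds_in_open) auto
    then have "\<forall>\<^sub>F z in nhds x. f x \<le> f z"
      by eventually_elim (use x(2) in \<open>auto simp: A_def\<close>)
    with has_laplacian_local_min[OF L(2)] L(1) show False by simp
  qed
  with x(2)[OF \<open>p \<in> A\<close>] show ?thesis by simp
qed

text \<open>The function is bounded below on a small ball around \<open>p\<close>. On a larger ball that
  contains \<open>q\<close>, compare it with a small multiple of Hopf's barrier
  \<open>h = exp (- \<alpha> r\<^sup>2) - exp (- \<alpha> R\<^sup>2)\<close>: for large \<open>\<alpha>\<close> one has \<open>\<Delta> h > K h\<close> outside the small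
  ball, \<open>K\<close> being a bound for \<open>\<bar>V\<bar>\<close>. As the larger ball may have any radius, one
  comparison reaches every \<open>q\<close>, with no chain of balls.\<close>

lemma strong_minimum_principle:
  fixes f :: "'a::euclidean_space \<Rightarrow> real"
  assumes cont: "continuous_on UNIV f" and nn: "\<And>x. f x \<ge> 0"
    and V: "continuous_on UNIV V"
    and lap: "\<And>x. has_laplacian f x (V x * f x)"
    and p: "f p > 0"
  shows "f q > 0"
proof -
  have "open {x. f x > f p / 2}"
    using cont by (intro open_Collect_less continuous_intros)
  moreover have "p \<in> {x. f x > f p / 2}" using p by simp
  ultimately obtain \<rho> where \<rho>: "\<rho> > 0" "cball p \<rho> \<subseteq> {x. f x > f p / 2}"
    unfolding open_contains_cball by blast
  define R where "R = norm (q - p) + \<rho> + 1"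
  have "bounded (V ` cball p R)"
    using V by (intro compact_imp_bounded compact_continuous_image compact_cball)
      (auto intro: continuous_on_subset)
  then obtain K where K: "K > 0" "\<And>x. x \<in> cball p R \<Longrightarrow> \<bar>V x\<bar> \<le> K"
    unfolding bounded_pos by auto
  \<comment> \<open>chosen so that \<open>4 \<alpha> \<rho>\<^sup>2 > 2 N + K\<close> and \<open>\<alpha> \<ge> 1\<close>\<close>
  define \<alpha> where "\<alpha> = (2 * DIM('a) + K) / (4 * \<rho>\<^sup>2) + 1"
  have \<alpha>: "\<alpha> \<ge> 1" using K(1) \<rho>(1) by (simp add: \<alpha>_def)
  \<comment> \<open>the right hand side is \<open>exp (\<alpha> s) \<Delta> h\<close> at squared radius \<open>s\<close>\<close>
  have big: "K < 4 * \<alpha>\<^sup>2 * s - 2 * \<alpha> * DIM('a)" if s: "s \<ge> \<rho>\<^sup>2" for s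
  proof -
    have "4 * \<rho>\<^sup>2 * \<alpha> = 2 * DIM('a) + K + 4 * \<rho>\<^sup>2"
      using \<rho>(1) by (simp add: \<alpha>_def field_simps)
    then have "4 * \<alpha> * s > 2 * DIM('a) + K"
      using mult_left_mono[OF s, of "4 * \<alpha>"] \<alpha> zero_less_power[OF \<rho>(1), of 2]
      by (simp only: mult.commute mult.left_commute) linarith
    then have "\<alpha> * (4 * \<alpha> * s - 2 * DIM('a)) > \<alpha> * K"
      using \<alpha> by (intro mult_strict_left_mono) auto
    moreover have "\<alpha> * K \<ge> K" using \<alpha> K(1) by simp
    ultimately show ?thesis by (simp add: power2_eq_square algebra_simps)
  qed
  define h where "h = (\<lambda>x. exp (- \<alpha> * (norm (x - p))\<^sup>2) + (- exp (- \<alpha> * R\<^sup>2)))"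
  define \<epsilon> where "\<epsilon> = f p / 2"
  have \<epsilon>: "\<epsilon> > 0" using p by (simp add: \<epsilon>_def)
  have h1: "h x \<le> 1" for x
    using \<alpha> unfolding h_def by (smt (verit) exp_gt_zero exp_le_one_iff mult_nonneg_nonneg zero_le_power2 mult_minus_left)
  have hlap: "has_laplacian h x
      (exp (- \<alpha> * (norm (x - p))\<^sup>2) * (4 * \<alpha>\<^sup>2 * (norm (x - p))\<^sup>2 - 2 * \<alpha> * DIM('a)))"
    if "x \<noteq> p" for x
  proof -
    have "has_laplacian (\<lambda>z. exp (- \<alpha> * (norm (z - p))\<^sup>2)) x
      (4 * (norm (x - p))\<^sup>2 * (\<alpha>\<^sup>2 * exp (- \<alpha> * (norm (x - p))\<^sup>2))
        + 2 * real DIM('a) * (- \<alpha> * exp (- \<alpha> * (norm (x - p))\<^sup>2)))"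
      by (rule has_laplacian_radial[OF that, where g = "\<lambda>s. exp (- \<alpha> * s)"
            and g' = "\<lambda>s. - \<alpha> * exp (- \<alpha> * s)"])
        (auto intro!: derivative_eq_intros simp: power2_eq_square)
    from has_laplacian_add[OF this has_laplacian_const[of "- exp (- \<alpha> * R\<^sup>2)"]]
    show ?thesis unfolding h_def by (simp add: algebra_simps)
  qed
  define g where "g = (\<lambda>x. f x + (- \<epsilon>) * h x)"
  have g: "g x \<ge> 0" if x: "\<rho> \<le> norm (x - p)" "norm (x - p) \<le> R" for x
  proof (rule annulus_comparison[OF _ _ _ _ x])
    show "continuous_on {x. \<rho> \<le> norm (x - p) \<and> norm (x - p) \<le> R} g"
      unfolding g_def h_def
      by (intro continuous_intros continuous_on_subset[OF cont]) auto
  next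
    fix x assume "norm (x - p) = \<rho>"
    then have "x \<in> cball p \<rho>" by (simp add: dist_norm norm_minus_commute)
    then have "f x > \<epsilon>" using \<rho>(2) by (auto simp: \<epsilon>_def)
    moreover have "\<epsilon> * h x \<le> \<epsilon> * 1" using h1 \<epsilon> by (intro mult_left_mono) auto
    ultimately show "g x \<ge> 0" by (simp add: g_def)
  next
    fix x assume "norm (x - p) = R"
    then show "g x \<ge> 0" using nn by (simp add: g_def h_def)
  next
    fix x assume x: "\<rho> < norm (x - p)" "norm (x - p) < R" "g x < 0"
    define E where "E = exp (- \<alpha> * (norm (x - p))\<^sup>2)"
    define M where "M = 4 * \<alpha>\<^sup>2 * (norm (x - p))\<^sup>2 - 2 * \<alpha> * DIM('a)"
    have E: "E > 0" "h x \<le> E" by (auto simp: E_def h_def)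
    have M: "K < M" unfolding M_def
      using x(1) \<rho>(1) by (intro big power_mono) auto
    have ne: "x \<noteq> p" using x(1) \<rho>(1) by auto
    have "has_laplacian g x (V x * f x + (- \<epsilon>) * (E * M))"
      unfolding g_def E_def M_def
      by (intro has_laplacian_add lap has_laplacian_cmult hlap ne)
    moreover have "V x * f x + (- \<epsilon>) * (E * M) < 0"
    proof -
      have "V x * f x \<le> K * f x"
        using K(2)[of x] x(2) nn[of x]
        by (intro mult_right_mono) (auto simp: dist_norm norm_minus_commute)
      also have "\<dots> \<le> K * (\<epsilon> * h x)" using x(3) K(1) by (simp add: g_def)
      also have "\<dots> \<le> K * (\<epsilon> * E)" using E K(1) \<epsilon> by simp
      also have "\<dots> < M * (\<epsilon> * E)" using M E \<epsilon> by simp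
      finally show ?thesis by (simp add: algebra_simps)
    qed
    ultimately show "\<exists>L<0. has_laplacian g x L" by blast
  qed
  show ?thesis
  proof (cases "norm (q - p) \<le> \<rho>")
    case True
    then have "q \<in> cball p \<rho>" by (simp add: dist_norm norm_minus_commute)
    then have "f q > f p / 2" using \<rho>(2) by auto
    then show ?thesis using p by simp
  next
    case False
    have "norm (q - p) < R" using \<rho>(1) by (simp add: R_def)
    then have "(norm (q - p))\<^sup>2 < R\<^sup>2" by (intro power_strict_mono) auto
    then have "h q > 0" using \<alpha> by (simp add: h_def)
    then have "\<epsilon> * h q > 0" using \<epsilon> by simp
    moreover have "g q \<ge> 0" using False \<open>norm (q - p) < R\<close> by (intro g) auto
    ultimately show ?thesis by (simp add: g_def)
  qed
qed

text \<open>Let \<open>W a\<close> be the minimum over the closed unit ball. For every \<open>\<delta> > 0\<close> the function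
  \<open>W - W a + \<delta> ln \<bar>z\<bar>\<close> is nonnegative on the unit sphere and, since \<open>W \<ge> 0\<close>, on all large
  spheres; its Laplacian is negative because \<open>\<Delta> ln \<bar>z\<bar> = (N - 2) / \<bar>z\<bar>\<^sup>2 \<le> 0\<close>. The
  dimension enters here and nowhere else. Hence \<open>W \<ge> W a - \<delta> ln \<bar>x\<bar>\<close> outside the unit
  ball, and with \<open>\<delta> \<rightarrow> 0\<close> the point \<open>a\<close> is a global minimum.\<close>

lemma no_strictly_superharmonic_nonneg:
  fixes W :: "'a::euclidean_space \<Rightarrow> real"
  assumes dim: "DIM('a) \<le> 2" and cont: "continuous_on UNIV W" and nn: "\<And>x. W x \<ge> 0"
    and lap: "\<And>x. \<exists>L<0. has_laplacian W x L"
  shows False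
proof -
  have "continuous_on (cball 0 1) W"
    using cont continuous_on_subset by blast
  from continuous_attains_inf[OF compact_cball _ this]
  obtain a where "\<forall>x\<in>cball 0 1. W a \<le> W x" by auto
  then have a: "\<And>x. norm x \<le> 1 \<Longrightarrow> W a \<le> W x" by simp
  have "W a \<le> W x" for x
  proof (cases "norm x \<le> 1")
    case False
    have "W a - W x \<le> \<epsilon>" if "\<epsilon> > 0" for \<epsilon>
    proof -
      \<comment> \<open>the coefficient for which the logarithmic term costs exactly \<open>\<epsilon>\<close> at \<open>x\<close>\<close>
      define \<delta> where "\<delta> = \<epsilon> / ln (norm x)"
      have lnx: "ln (norm x) > 0" using False by (intro ln_gt_zero) simp
      have \<delta>: "\<delta> > 0" using that lnx by (simp add: \<delta>_def)
      \<comment> \<open>beyond this radius \<open>\<delta> ln \<bar>z\<bar> \<ge> W a\<close>\<close>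
      define R where "R = max (norm x) (exp (W a / \<delta>))"
      have R: "R > 1" "norm x \<le> R" "exp (W a / \<delta>) \<le> R" using False by (auto simp: R_def)
      define f where "f = (\<lambda>z. (W z + - W a) + \<delta> * (ln ((norm (z - 0))\<^sup>2) / 2))"
      have "f x \<ge> 0"
      proof (rule annulus_comparison[where f = f and p = x and c = 0 and r = 1 and R = R])
        show "continuous_on {z. 1 \<le> norm (z - 0) \<and> norm (z - 0) \<le> R} f"
          unfolding f_def
          by (intro continuous_intros continuous_on_subset[OF cont]) auto
      next
        fix z :: 'a assume "norm (z - 0) = 1"
        then show "f z \<ge> 0" using a[of z] by (simp add: f_def)
      next
        fix z :: 'a assume z: "norm (z - 0) = R"
        have "ln (exp (W a / \<delta>)) \<le> ln R" using R by (subst ln_le_cancel_iff) auto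
        then have "W a \<le> \<delta> * ln R" using \<delta> by (simp add: field_simps)
        moreover have "ln (R\<^sup>2) = 2 * ln R" using R by (simp add: ln_realpow)
        ultimately show "f z \<ge> 0" using nn[of z] z by (simp add: f_def)
      next
        fix z :: 'a assume z: "1 < norm (z - 0)"
        then have z0: "z \<noteq> 0" by auto
        define s where "s = (norm (z - 0))\<^sup>2"
        have s: "s > 0" using z0 by (simp add: s_def)
        obtain L where L: "L < 0" "has_laplacian W z L" using lap by blast
        have "has_laplacian (\<lambda>z. ln ((norm (z - 0))\<^sup>2) / 2) z
            (4 * (norm (z - 0))\<^sup>2 * (- 1 / (2 * s\<^sup>2)) + 2 * real DIM('a) * (1 / (2 * (norm (z - 0))\<^sup>2)))"
          using s unfolding s_def
          by (intro has_laplacian_radial[OF z0, where g = "\<lambda>s. ln s / 2" and g' = "\<lambda>s. 1 / (2 * s)"])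
            (auto intro!: derivative_eq_intros simp: power2_eq_square)
        moreover have "4 * s * (- 1 / (2 * s\<^sup>2)) + 2 * real DIM('a) * (1 / (2 * s))
            = (real DIM('a) - 2) / s"
          using s by (simp add: field_simps power2_eq_square)
        ultimately have "has_laplacian (\<lambda>z. ln ((norm (z - 0))\<^sup>2) / 2) z
            ((real DIM('a) - 2) / s)"
          by (simp only: s_def)
        then have "has_laplacian f z ((L + 0) + \<delta> * ((real DIM('a) - 2) / s))"
          unfolding f_def
          by (intro has_laplacian_add L has_laplacian_const has_laplacian_cmult)
        moreover have "(real DIM('a) - 2) / s \<le> 0"
          using dim s by (intro divide_nonpos_pos) auto
        then have "\<delta> * ((real DIM('a) - 2) / s) \<le> 0"
          using \<delta> by (intro mult_nonneg_nonpos) auto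
        then have "(L + 0) + \<delta> * ((real DIM('a) - 2) / s) < 0"
          using L(1) by linarith
        ultimately show "\<exists>L<0. has_laplacian f z L" by blast
      qed (use False R in auto)
      moreover have "ln ((norm x)\<^sup>2) = 2 * ln (norm x)" using False by (simp add: ln_realpow)
      ultimately show ?thesis using lnx by (simp add: f_def \<delta>_def)
    qed
    then show ?thesis
      using field_le_epsilon[of "W a" "W x"] by (simp add: algebra_simps)
  qed (use a in auto)
  moreover obtain L where "L < 0" "has_laplacian W a L" using lap by blast
  ultimately show False
    using has_laplacian_local_min[of W a L] by auto
qed

section \<open>Weighted geometric means\<close>

text \<open>Write \<open>W = exp g\<close> along the line, so that \<open>W'' = W (g'' + g'\<^sup>2)\<close> with
  \<open>g' = \<Sum> y\<^sub>i q\<^sub>i\<close>, \<open>q\<^sub>i = \<phi>\<^sub>i' / \<phi>\<^sub>i\<close> and \<open>g'' = \<Sum> y\<^sub>i (\<phi>\<^sub>i'' / \<phi>\<^sub>i - q\<^sub>i\<^sup>2)\<close>. As the weights sum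
  to one, \<open>(\<Sum> y\<^sub>i q\<^sub>i)\<^sup>2 \<le> \<Sum> y\<^sub>i q\<^sub>i\<^sup>2\<close>, and the terms with first derivatives can be dropped.\<close>

lemma geometric_mean_second_dir_deriv:
  fixes u :: "'i \<Rightarrow> 'a::real_vector \<Rightarrow> real"
  assumes J: "finite J" and y: "\<And>i. i \<in> J \<Longrightarrow> y i \<ge> 0" "sum y J = 1"
    and d: "\<And>i. i \<in> J \<Longrightarrow> second_dir_deriv (u i) b x (d i)"
    and pos: "\<And>i. i \<in> J \<Longrightarrow> u i x > 0"
  defines "W \<equiv> \<lambda>z. exp (\<Sum>i\<in>J. y i * ln (u i z))"
  shows "\<exists>e \<le> W x * (\<Sum>i\<in>J. y i * (d i / u i x)). second_dir_deriv W b x e"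
proof -
  define \<phi> where "\<phi> = (\<lambda>i s. u i (x + s *\<^sub>R b))"
  have "\<forall>i\<in>J. \<exists>f'. (\<forall>\<^sub>F t in nhds 0. (\<phi> i has_real_derivative f' t) (at t)) \<and>
           (f' has_real_derivative d i) (at 0)"
    using d unfolding second_dir_deriv_def \<phi>_def by blast
  then obtain \<phi>' where \<phi>':
      "\<And>i. i \<in> J \<Longrightarrow> \<forall>\<^sub>F t in nhds 0. (\<phi> i has_real_derivative \<phi>' i t) (at t)"
      "\<And>i. i \<in> J \<Longrightarrow> (\<phi>' i has_real_derivative d i) (at 0)"
    by metis
  have \<phi>0: "\<phi> i 0 = u i x" for i by (simp add: \<phi>_def)
  have der0: "(\<phi> i has_real_derivative \<phi>' i 0) (at 0)" if "i \<in> J" for i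
    using \<phi>'(1)[OF that] eventually_nhds_x_imp_x by fastforce
  have ev: "\<forall>\<^sub>F t in nhds 0. \<forall>i\<in>J. (\<phi> i has_real_derivative \<phi>' i t) (at t) \<and> \<phi> i t > 0"
  proof (intro eventually_ball_finite[OF J] ballI eventually_conj \<phi>')
    fix i assume i: "i \<in> J"
    have "(\<phi> i \<longlongrightarrow> \<phi> i 0) (nhds 0)"
      using DERIV_isCont[OF der0[OF i]] by (simp add: continuous_at tendsto_at_iff_tendsto_nhds)
    then show "\<forall>\<^sub>F t in nhds 0. \<phi> i t > 0"
      using pos[OF i] \<phi>0 by (simp add: order_tendstoD(1))
  qed
  define w where "w = (\<lambda>s. exp (\<Sum>i\<in>J. y i * ln (\<phi> i s)))"
  have w: "w s = W (x + s *\<^sub>R b)" for s by (simp add: w_def W_def \<phi>_def)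
  define l where "l = (\<lambda>t. \<Sum>i\<in>J. y i * (\<phi>' i t / \<phi> i t))"
  have dw: "(w has_real_derivative w t * l t) (at t)"
    if "\<forall>i\<in>J. (\<phi> i has_real_derivative \<phi>' i t) (at t) \<and> \<phi> i t > 0" for t
  proof -
    have "((\<lambda>s. \<Sum>i\<in>J. y i * ln (\<phi> i s)) has_real_derivative l t) (at t)"
      unfolding l_def
    proof (rule DERIV_sum, rule DERIV_cmult)
      fix i assume "i \<in> J"
      then show "((\<lambda>s. ln (\<phi> i s)) has_real_derivative \<phi>' i t / \<phi> i t) (at t)"
        using that by (auto intro!: derivative_eq_intros)
    qed
    then show ?thesis unfolding w_def by (rule DERIV_fun_exp)
  qed
  define q where "q = (\<lambda>i. \<phi>' i 0 / \<phi> i 0)"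
  define l' where "l' = (\<Sum>i\<in>J. y i * (d i / \<phi> i 0 - (q i)\<^sup>2))"
  have "(l has_real_derivative l') (at 0)"
    unfolding l_def l'_def
  proof (rule DERIV_sum, rule DERIV_cmult)
    fix i assume i: "i \<in> J"
    have "\<phi> i 0 \<noteq> 0" using pos[OF i] \<phi>0 by simp
    then show "((\<lambda>t. \<phi>' i t / \<phi> i t) has_real_derivative d i / \<phi> i 0 - (q i)\<^sup>2) (at 0)"
      using der0[OF i] \<phi>'(2)[OF i]
      by (auto intro!: derivative_eq_intros simp: q_def field_simps power2_eq_square)
  qed
  moreover have "(w has_real_derivative w 0 * l 0) (at 0)"
    using dw[of 0] eventually_nhds_x_imp_x[OF ev] by blast
  ultimately have "((\<lambda>t. w t * l t) has_real_derivative w 0 * (l' + (l 0)\<^sup>2)) (at 0)"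
    by (auto intro!: derivative_eq_intros simp: algebra_simps power2_eq_square)
  moreover have "\<forall>\<^sub>F t in nhds 0. (w has_real_derivative w t * l t) (at t)"
    using ev by eventually_elim (rule dw)
  ultimately have "second_dir_deriv W b x (w 0 * (l' + (l 0)\<^sup>2))"
    by (intro second_dir_derivI) (simp_all only: w[symmetric])
  moreover have "w 0 * (l' + (l 0)\<^sup>2) \<le> W x * (\<Sum>i\<in>J. y i * (d i / u i x))"
  proof -
    have "(l 0)\<^sup>2 \<le> (\<Sum>i\<in>J. y i * (q i)\<^sup>2)"
    proof -
      \<comment> \<open>nonnegativity of the variance of \<open>q\<close> under the weights \<open>y\<close>\<close>
      have "0 \<le> (\<Sum>i\<in>J. y i * (q i - l 0)\<^sup>2)"
        using y by (intro sum_nonneg) simp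
      also have "\<dots> = (\<Sum>i\<in>J. y i * (q i)\<^sup>2) - 2 * l 0 * (\<Sum>i\<in>J. y i * q i) + (l 0)\<^sup>2 * sum y J"
        by (simp add: power2_diff algebra_simps sum.distrib sum_subtractf sum_distrib_left
            sum_distrib_right)
      also have "(\<Sum>i\<in>J. y i * q i) = l 0" by (simp add: l_def q_def)
      finally show ?thesis by (simp add: y power2_eq_square algebra_simps)
    qed
    moreover have "l' = (\<Sum>i\<in>J. y i * (d i / u i x)) - (\<Sum>i\<in>J. y i * (q i)\<^sup>2)"
      by (simp add: l'_def \<phi>0 algebra_simps sum_subtractf)
    moreover have "w 0 = W x" "W x > 0" by (auto simp: w W_def)
    ultimately show ?thesis by simp
  qed
  ultimately show ?thesis by blast
qed

lemma geometric_mean_has_laplacian: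
  fixes u :: "'i \<Rightarrow> 'a::euclidean_space \<Rightarrow> real"
  assumes J: "finite J" and y: "\<And>i. i \<in> J \<Longrightarrow> y i \<ge> 0" "sum y J = 1"
    and lap: "\<And>i. i \<in> J \<Longrightarrow> has_laplacian (u i) x (\<Lambda> i)"
    and pos: "\<And>i. i \<in> J \<Longrightarrow> u i x > 0"
  defines "W \<equiv> \<lambda>z. exp (\<Sum>i\<in>J. y i * ln (u i z))"
  shows "\<exists>L \<le> W x * (\<Sum>i\<in>J. y i * (\<Lambda> i / u i x)). has_laplacian W x L"
proof -
  obtain d where d: "\<And>i b. i \<in> J \<Longrightarrow> b \<in> Basis \<Longrightarrow> second_dir_deriv (u i) b x (d i b)"
      "\<And>i. i \<in> J \<Longrightarrow> \<Lambda> i = (\<Sum>b\<in>Basis. d i b)"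
    using lap unfolding has_laplacian_def by metis
  have "\<forall>b\<in>Basis. \<exists>e \<le> W x * (\<Sum>i\<in>J. y i * (d i b / u i x)). second_dir_deriv W b x e"
    unfolding W_def
    by (intro ballI geometric_mean_second_dir_deriv[OF J y d(1) pos])
  then obtain e where e: "\<And>b. b \<in> Basis \<Longrightarrow> e b \<le> W x * (\<Sum>i\<in>J. y i * (d i b / u i x))"
      "\<And>b. b \<in> Basis \<Longrightarrow> second_dir_deriv W b x (e b)"
    by metis
  have "(\<Sum>b\<in>Basis. e b) \<le> (\<Sum>b\<in>Basis. W x * (\<Sum>i\<in>J. y i * (d i b / u i x)))"
    by (intro sum_mono e)
  also have "\<dots> = W x * (\<Sum>b\<in>Basis. \<Sum>i\<in>J. y i * (d i b / u i x))"
    by (rule sum_distrib_left[symmetric])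
  also have "(\<Sum>b\<in>Basis. \<Sum>i\<in>J. y i * (d i b / u i x))
      = (\<Sum>i\<in>J. \<Sum>b\<in>Basis. y i * (d i b / u i x))"
    by (rule sum.swap)
  also have "(\<Sum>i\<in>J. \<Sum>b\<in>Basis. y i * (d i b / u i x)) = (\<Sum>i\<in>J. y i * (\<Lambda> i / u i x))"
    by (intro sum.cong refl) (simp add: d(2) sum_divide_distrib sum_distrib_left)
  finally show ?thesis
    using e(2) unfolding has_laplacian_def by blast
qed

section \<open>Weights from strict copositivity\<close>

text \<open>Let \<open>y\<close> minimise \<open>c \<bullet> B c\<close> over the simplex of probability vectors supported in \<open>J\<close>.
  Moving from \<open>y\<close> towards the vertex \<open>e\<^sub>j\<close> cannot decrease the form, so its first variation
  \<open>2 (e\<^sub>j - y) \<bullet> B y\<close>, by symmetry of \<open>B\<close>, is nonnegative. Hence \<open>(B y)\<^sub>j \<ge> y \<bullet> B y > 0\<close>.\<close>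

lemma copositive_weights:
  fixes B :: "real^'n^'n"
  assumes sym: "transpose B = B" and cop: "strictly_copositive B" and ne: "J \<noteq> {}"
  obtains y :: "real^'n" where "\<And>i. y $ i \<ge> 0" "\<And>i. i \<notin> J \<Longrightarrow> y $ i = 0"
    "(\<Sum>i\<in>J. y $ i) = 1" "\<And>j. j \<in> J \<Longrightarrow> (B *v y) $ j > 0"
proof -
  \<comment> \<open>the simplex; coordinates outside \<open>J\<close> vanish, written with two inequalities\<close>
  define S where "S = {c :: real^'n. (\<forall>i. 0 \<le> c $ i \<and> (i \<notin> J \<longrightarrow> c $ i \<le> 0)) \<and> (\<Sum>i\<in>J. c $ i) = 1}"
  have B: "a \<bullet> (B *v c) = c \<bullet> (B *v a)" for a c :: "real^'n"
    by (metis dot_lmul_matrix sym inner_commute transpose_matrix_vector)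
  have "closed S"
    unfolding S_def by (intro closed_Collect_conj closed_Collect_all closed_Collect_imp
        closed_Collect_le closed_Collect_eq continuous_intros) (auto simp: open_Collect_const)
  moreover have "bounded S"
  proof -
    have "norm c \<le> 1" if "c \<in> S" for c
    proof -
      have "norm c \<le> (\<Sum>i\<in>UNIV. \<bar>c $ i\<bar>)" by (rule norm_le_l1_cart)
      also have "\<dots> = (\<Sum>i\<in>J. c $ i)"
        using that by (intro sum.mono_neutral_cong_right) (auto simp: S_def intro: antisym)
      finally show ?thesis using that by (simp add: S_def)
    qed
    then show ?thesis unfolding bounded_iff by blast
  qed
  ultimately have "compact S" by (simp add: compact_eq_bounded_closed)
  have ax: "axis j 1 \<in> S" if "j \<in> J" for j
    using that by (auto simp: S_def axis_def sum.delta)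
  then have "S \<noteq> {}" using ne by blast
  have "continuous_on S (\<lambda>c. c \<bullet> (B *v c))"
    by (intro continuous_on_inner continuous_on_id matrix_vector_mult_linear_continuous_on)
  then obtain y where y: "y \<in> S" "\<And>c. c \<in> S \<Longrightarrow> y \<bullet> (B *v y) \<le> c \<bullet> (B *v c)"
    using continuous_attains_inf[OF \<open>compact S\<close> \<open>S \<noteq> {}\<close>] by blast
  have "y \<noteq> 0" using y(1) by (auto simp: S_def)
  then have pos: "y \<bullet> (B *v y) > 0"
    using cop y(1) unfolding strictly_copositive_def
    by (auto simp: S_def inner_vec_def matrix_vector_mult_def sum_distrib_left mult_ac)
  have "(B *v y) $ j > 0" if j: "j \<in> J" for j
  proof (rule ccontr)
    assume neg: "\<not> (B *v y) $ j > 0"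
    define v where "v = axis j 1 - y"
    have vy: "v \<bullet> (B *v y) < 0"
      using neg pos by (simp add: v_def inner_diff_left inner_axis' )
    \<comment> \<open>a step length in \<open>(0, 1]\<close> so short that the linear term outweighs the quadratic one\<close>
    define D where "D = \<bar>v \<bullet> (B *v v)\<bar> + 1 - v \<bullet> (B *v y)"
    define t where "t = - (v \<bullet> (B *v y)) / D"
    have D: "D > 0" using vy by (simp add: D_def)
    have t: "0 < t" "t \<le> 1" using vy D by (auto simp: t_def D_def field_simps)
    have "y + t *\<^sub>R v = (1 - t) *\<^sub>R y + t *\<^sub>R axis j 1"
      by (simp add: v_def algebra_simps)
    also have "\<dots> \<in> S"
      using y(1) ax[OF j] t unfolding S_def
      by (auto simp: sum.distrib sum_distrib_left[symmetric] mult_nonneg_nonpos add_nonneg_nonneg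
          add_nonpos_nonpos)
    finally have "y \<bullet> (B *v y) \<le> (y + t *\<^sub>R v) \<bullet> (B *v (y + t *\<^sub>R v))"
      using y(2) by blast
    also have "\<dots> = y \<bullet> (B *v y) + t * (2 * (v \<bullet> (B *v y)) + t * (v \<bullet> (B *v v)))"
      by (simp add: matrix_vector_right_distrib matrix_vector_mult_scaleR inner_add_left
          inner_add_right B[of y v] algebra_simps)
    finally have "0 \<le> 2 * (v \<bullet> (B *v y)) + t * (v \<bullet> (B *v v))"
      using t by (simp add: zero_le_mult_iff)
    moreover have "t * (v \<bullet> (B *v v)) \<le> t * D"
      using t vy by (intro mult_left_mono) (auto simp: D_def)
    moreover have "t * D = - (v \<bullet> (B *v y))" using D by (simp add: t_def)
    ultimately show False using vy by simp
  qed
  with y(1) show ?thesis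
    by (intro that[of y]) (auto simp: S_def intro: antisym)
qed

section \<open>Nonexistence of nontrivial solutions\<close>

theorem theorem1p3:
  fixes B :: "real^'n^'n"
  assumes "CARD('N::finite) \<in> {1, 2}"
    and "CARD('n) \<ge> 2"
    and "transpose B = B"
    and "strictly_copositive B"
  shows "\<not> (\<exists>u :: real^'N \<Rightarrow> real^'n. is_solution B u \<and> nontrivial u)"
proof
  assume "\<exists>u :: real^'N \<Rightarrow> real^'n. is_solution B u \<and> nontrivial u"
  then obtain u :: "real^'N \<Rightarrow> real^'n" where sol: "is_solution B u" and nt: "nontrivial u"
    by blast
  define V where "V = (\<lambda>i x. - (\<Sum>j\<in>UNIV. B $ i $ j * (u x $ j)\<^sup>2))"
  have C2: "C2 (\<lambda>x. u x $ i)" and nn: "u x $ i \<ge> 0" for i x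
    using sol unfolding is_solution_def by auto
  have cont: "continuous_on UNIV (\<lambda>x. u x $ i)" for i
    by (rule C2_continuous[OF C2])
  have Vcont: "continuous_on UNIV (V i)" for i
    unfolding V_def by (intro continuous_intros cont)
  have lap: "has_laplacian (\<lambda>x. u x $ i) x (V i x * u x $ i)" for i x
  proof -
    have "- laplacian (\<lambda>y. u y $ i) x = (\<Sum>j\<in>UNIV. B $ i $ j * (u x $ j)\<^sup>2 * u x $ i)"
      using sol unfolding is_solution_def by blast
    then have "laplacian (\<lambda>y. u y $ i) x = V i x * u x $ i"
      by (simp add: V_def sum_distrib_right)
    then show ?thesis using C2_has_laplacian[OF C2, of i x] by simp
  qed
  define J where "J = {i. \<exists>x. u x $ i \<noteq> 0}"
  have "J \<noteq> {}" using nt by (auto simp: nontrivial_def J_def fun_eq_iff)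
  have pos: "u x $ i > 0" if i: "i \<in> J" for i x
  proof -
    obtain p where "u p $ i \<noteq> 0" using i by (auto simp: J_def)
    then have "u p $ i > 0" using nn[of p i] by simp
    then show ?thesis
      using strong_minimum_principle[OF cont nn Vcont lap] by blast
  qed
  have zero: "u x $ i = 0" if "i \<notin> J" for i x using that by (auto simp: J_def)
  obtain y :: "real^'n" where y: "\<And>i. y $ i \<ge> 0" "\<And>i. i \<notin> J \<Longrightarrow> y $ i = 0"
    "(\<Sum>i\<in>J. y $ i) = 1" "\<And>j. j \<in> J \<Longrightarrow> (B *v y) $ j > 0"
    using copositive_weights[OF assms(3,4) \<open>J \<noteq> {}\<close>] by blast
  define W where "W = (\<lambda>x. exp (\<Sum>i\<in>J. y $ i * ln (u x $ i)))"
  have "\<exists>L<0. has_laplacian W x L" for x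
  proof -
    have Bsym: "B $ i $ j = B $ j $ i" for i j
      using assms(3) by (metis transpose_def vec_lambda_beta)
    have "(\<Sum>i\<in>J. y $ i * (V i x * u x $ i / u x $ i)) = (\<Sum>i\<in>J. y $ i * V i x)"
      using pos by (intro sum.cong) (auto simp: less_imp_neq[THEN not_sym])
    also have "\<dots> = (\<Sum>i\<in>UNIV. y $ i * V i x)"
      by (intro sum.mono_neutral_left) (auto simp: y(2))
    also have "\<dots> = - (\<Sum>i\<in>UNIV. \<Sum>j\<in>UNIV. y $ i * (B $ i $ j * (u x $ j)\<^sup>2))"
      by (simp add: V_def sum_distrib_left sum_negf)
    also have "\<dots> = - (\<Sum>j\<in>UNIV. \<Sum>i\<in>UNIV. y $ i * (B $ i $ j * (u x $ j)\<^sup>2))"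
      by (subst sum.swap) simp
    also have "\<dots> = - (\<Sum>j\<in>UNIV. (B *v y) $ j * (u x $ j)\<^sup>2)"
      by (simp add: matrix_vector_mult_def sum_distrib_right sum_distrib_left mult_ac)
        (simp add: Bsym)
    also have "(\<Sum>j\<in>UNIV. (B *v y) $ j * (u x $ j)\<^sup>2) = (\<Sum>j\<in>J. (B *v y) $ j * (u x $ j)\<^sup>2)"
      by (intro sum.mono_neutral_right) (auto simp: zero)
    also have "- \<dots> < 0"
      using y(4) pos[of _ x] \<open>J \<noteq> {}\<close> by (auto intro!: sum_pos simp: less_imp_neq[THEN not_sym])
    finally have "W x * (\<Sum>i\<in>J. y $ i * (V i x * u x $ i / u x $ i)) < 0"
      by (simp add: mult_pos_neg W_def)
    moreover have "\<exists>L \<le> W x * (\<Sum>i\<in>J. y $ i * (V i x * u x $ i / u x $ i)). has_laplacian W x L"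
      using geometric_mean_has_laplacian[of J "\<lambda>i. y $ i" "\<lambda>i x. u x $ i" x
          "\<lambda>i. V i x * u x $ i", OF finite y(1) y(3) lap pos]
      by (simp only: W_def)
    ultimately show ?thesis by (meson le_less_trans)
  qed
  moreover have "continuous_on UNIV W"
    unfolding W_def using pos
    by (intro continuous_intros cont) (auto simp: less_imp_neq[THEN not_sym])
  moreover have "DIM(real^'N) \<le> 2" using assms(1) by auto
  moreover have "W x \<ge> 0" for x by (simp add: W_def)
  ultimately show False
    using no_strictly_superharmonic_nonneg[of W] by blast
qed

end
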